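(* The scalar $\gamma_1:=c(0,1)/c(0,0)$ can be calculated algebraically as follows: $$\gamma_1=\frac{b_0^u-\sum_{j=1}^\infty b_j^z\eta_j}{b_1^d+\sum_{j=1}^\infty b_j^z\rho_j}.$$
   Context: Indices run over $0,1,2,\ldots$. Let $b_i^d,b_i^u$ ($i\ge 0$) and $b_i^z$ ($i\ge1$) be non-negative real numbers and let $b_i^w=b_i^z+b_i^d+b_i^u>0$ for $i\ge1$. The infinite matrix $B=(B(i,j))_{i,j\ge0}$ is defined by: $B(0,0)=-b_0^d-b_0^u$, $B(0,1)=b_0^u$; $B(1,0)=b_1^d+b_1^z$, $B(1,1)=-b_1^w$, $B(1,2)=b_1^u$; and for $i\ge2$: $B(i,0)=b_i^z$, $B(i,i-1)=b_i^d$, $B(i,i)=-b_i^w$, $B(i,i+1)=b_i^u$; all other entries are $0$. It is assumed that $b_i^d>0$ and $b_i^u>0$ for all $i\ge0$. $C=(c(i,j))_{i,j\ge0}$ denotes the inverse of $B$, i.e. $C=B^{-1}$, so that $CB=BC=I$. Here $c(0,0)=-1/b_0^d\neq0$. The scalars $\rho_j,\eta_j$ are defined by $\rho_1=1$, $\eta_1=0$, $\rho_2=b_1^w/b_2^d$, $\eta_2=-b_0^u/b_2^d$, and for $j\ge3$, $\rho_j=(b_{j-1}^w\rho_{j-1}-b_{j-2}^u\rho_{j-2})/b_j^d$ and $\eta_j=(b_{j-1}^w\eta_{j-1}-b_{j-2}^u\eta_{j-2})/b_j^d$.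
   Formalization: The two series may both diverge (e.g. all rates equal to 1), leaving the quotient undefined; the formula is proved as the limit of the quotients of partial sums, and literally whenever the series converge (they converge or diverge together). *)

theory Defs
  imports Complex_Main
begin

text \<open>Infinite matrices indexed by the naturals are functions of type \<open>nat \<Rightarrow> nat \<Rightarrow> real\<close>. The rates
  \<open>b\<^sup>d\<close>, \<open>b\<^sup>u\<close>, \<open>b\<^sup>z\<close> are sequences \<open>bd\<close>, \<open>bu\<close>, \<open>bz\<close>; the entry \<open>bz 0\<close> (and hence
  \<open>bw \<dots> 0\<close>) has no meaning and is never used below.\<close>

definition bw :: "(nat \<Rightarrow> real) \<Rightarrow> (nat \<Rightarrow> real) \<Rightarrow> (nat \<Rightarrow> real) \<Rightarrow> nat \<Rightarrow> real" where
  "bw bd bu bz i = bz i + bd i + bu i"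

definition Bmat :: "(nat \<Rightarrow> real) \<Rightarrow> (nat \<Rightarrow> real) \<Rightarrow> (nat \<Rightarrow> real) \<Rightarrow> nat \<Rightarrow> nat \<Rightarrow> real" where
  "Bmat bd bu bz i j =
    (if i = 0 then
       (if j = 0 then - bd 0 - bu 0
        else if j = 1 then bu 0
        else 0)
     else if i = 1 then
       (if j = 0 then bd 1 + bz 1
        else if j = 1 then - bw bd bu bz 1
        else if j = 2 then bu 1
        else 0)
     else
       (if j = 0 then bz i
        else if j = i - 1 then bd i
        else if j = i then - bw bd bu bz i
        else if j = i + 1 then bu i
        else 0))"

text \<open>\<open>matrix_prod_is M N P\<close>: every entry of the product \<open>M N\<close> is a convergent series with the
  corresponding entry of \<open>P\<close> as its sum. Convergence is not required to be absolute.\<close>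

definition matrix_prod_is ::
  "(nat \<Rightarrow> nat \<Rightarrow> real) \<Rightarrow> (nat \<Rightarrow> nat \<Rightarrow> real) \<Rightarrow> (nat \<Rightarrow> nat \<Rightarrow> real) \<Rightarrow> bool" where
  "matrix_prod_is M N P \<longleftrightarrow> (\<forall>i j. (\<lambda>k. M i k * N k j) sums P i j)"

definition id_matrix :: "nat \<Rightarrow> nat \<Rightarrow> real" where
  "id_matrix i j = (if i = j then 1 else 0)"

text \<open>Two-sided inverses of infinite matrices need not be unique, so this is a relation.\<close>

definition is_matrix_inverse :: "(nat \<Rightarrow> nat \<Rightarrow> real) \<Rightarrow> (nat \<Rightarrow> nat \<Rightarrow> real) \<Rightarrow> bool" where
  "is_matrix_inverse B C \<longleftrightarrow> matrix_prod_is C B id_matrix \<and> matrix_prod_is B C id_matrix"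

text \<open>The sequences \<open>\<rho>\<close> and \<open>\<eta>\<close> start at index 1; their values at 0 are dummies.
  In the last equation of each, the index \<open>j\<close> is \<open>n + 3\<close>.\<close>

fun rho :: "(nat \<Rightarrow> real) \<Rightarrow> (nat \<Rightarrow> real) \<Rightarrow> (nat \<Rightarrow> real) \<Rightarrow> nat \<Rightarrow> real" where
  "rho bd bu bz 0 = 0"
| "rho bd bu bz (Suc 0) = 1"
| "rho bd bu bz (Suc (Suc 0)) = bw bd bu bz 1 / bd 2"
| "rho bd bu bz (Suc (Suc (Suc n))) =
     (bw bd bu bz (n + 2) * rho bd bu bz (Suc (Suc n)) - bu (n + 1) * rho bd bu bz (Suc n))
       / bd (n + 3)"

fun eta :: "(nat \<Rightarrow> real) \<Rightarrow> (nat \<Rightarrow> real) \<Rightarrow> (nat \<Rightarrow> real) \<Rightarrow> nat \<Rightarrow> real" where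
  "eta bd bu bz 0 = 0"
| "eta bd bu bz (Suc 0) = 0"
| "eta bd bu bz (Suc (Suc 0)) = - bu 0 / bd 2"
| "eta bd bu bz (Suc (Suc (Suc n))) =
     (bw bd bu bz (n + 2) * eta bd bu bz (Suc (Suc n)) - bu (n + 1) * eta bd bu bz (Suc n))
       / bd (n + 3)"

end

theory Submission
  imports Defs
begin

text \<open>Row \<open>0\<close> of \<open>C B = I\<close> says that the row vector \<open>x\<^sub>k = c(0,k)\<close> satisfies \<open>x B = (1, 0, 0, \<dots>)\<close>.
  The columns \<open>j \<ge> 1\<close> form a three-term recurrence whose solutions are spanned by \<open>\<rho>\<close> and \<open>\<eta>\<close>, the
  solutions with initial values \<open>(0, 1)\<close> and \<open>(1, 0)\<close> at the indices \<open>0, 1\<close> (where \<open>\<eta>\<^sub>0\<close> is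
  read as \<open>1\<close>); so
  \<open>x\<^sub>j = x\<^sub>1 \<rho>\<^sub>j + x\<^sub>0 \<eta>\<^sub>j\<close> for \<open>j \<ge> 1\<close> (lemma \<open>balanced_eq_rho_eta\<close>). Because
  \<open>x\<^sub>0 = -1/b\<^sub>0\<^sup>d\<close>, the column \<open>0\<close> becomes homogeneous, and division by \<open>x\<^sub>0\<close> leaves
  \[ \sum_{j \ge 1} b_j^z (\gamma_1 \rho_j + \eta_j) = b_0^u - b_1^d \gamma_1. \]
  If \<open>N\<^sub>n\<close> and \<open>D\<^sub>n\<close> are the truncated numerator and denominator, this is the statement
  \<open>\<gamma>\<^sub>1 D\<^sub>n - N\<^sub>n \<rightarrow> 0\<close>.

  To divide by \<open>D\<^sub>n\<close> although the two series need not converge separately, one needs a lower bound.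
  Summing the recurrence gives a conservation law (lemma \<open>balanced_flux\<close>): the net flux
  \<open>b\<^sub>j\<^sub>+\<^sub>1\<^sup>d y\<^sub>j\<^sub>+\<^sub>1 - b\<^sub>j\<^sup>u y\<^sub>j\<close> of a solution \<open>y\<close> grows by \<open>b\<^sub>j\<^sup>z y\<^sub>j\<close> at each step. Applied to \<open>\<rho>\<close> and \<open>-\<eta>\<close>
  it shows by induction that both are non-negative at the indices \<open>j \<ge> 1\<close>. Hence \<open>D\<^sub>n \<ge> b\<^sub>1\<^sup>d > 0\<close>, which yields
  \<open>N\<^sub>n / D\<^sub>n \<rightarrow> \<gamma>\<^sub>1\<close>, and \<open>N\<^sub>n \<ge> b\<^sub>0\<^sup>u > 0\<close>, which forces \<open>\<gamma>\<^sub>1 \<noteq> 0\<close>. As the series of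
  \<open>b\<^sub>j\<^sup>z (\<gamma>\<^sub>1 \<rho>\<^sub>j + \<eta>\<^sub>j)\<close> converges and \<open>\<gamma>\<^sub>1 \<noteq> 0\<close>, the series of \<open>b\<^sub>j\<^sup>z \<rho>\<^sub>j\<close> and of
  \<open>b\<^sub>j\<^sup>z \<eta>\<^sub>j\<close> converge or diverge together.\<close>

text \<open>The equations expressing that the row vector \<open>y B\<close> vanishes in all columns from \<open>1\<close> on: in
  each state \<open>Suc j\<close> the flow into the state balances the flow out of it.\<close>

definition balanced ::
  "(nat \<Rightarrow> real) \<Rightarrow> (nat \<Rightarrow> real) \<Rightarrow> (nat \<Rightarrow> real) \<Rightarrow> (nat \<Rightarrow> real) \<Rightarrow> bool" where
  "balanced bd bu bz y \<longleftrightarrow>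
    (\<forall>j. bd (j + 2) * y (j + 2) = bw bd bu bz (Suc j) * y (Suc j) - bu j * y j)"

lemma balancedD:
  "balanced bd bu bz y \<Longrightarrow>
    bd (Suc (Suc j)) * y (Suc (Suc j)) = bw bd bu bz (Suc j) * y (Suc j) - bu j * y j"
  by (simp add: balanced_def)

lemma balanced_rho:
  assumes "\<And>i. bd i > 0"
  shows "balanced bd bu bz (rho bd bu bz)"
  unfolding balanced_def
proof
  fix j
  have nz: "bd i \<noteq> 0" for i
    using assms[of i] by simp
  show "bd (j + 2) * rho bd bu bz (j + 2)
      = bw bd bu bz (Suc j) * rho bd bu bz (Suc j) - bu j * rho bd bu bz j"
    using nz by (cases j) (simp_all add: numeral_2_eq_2 numeral_3_eq_3)
qed

text \<open>The special second value of \<open>\<eta>\<close> is what the recurrence produces from the value \<open>1\<close> at index \<open>0\<close>.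
  Replacing the dummy value there by \<open>1\<close> lets \<open>\<eta>\<close> obey the same equations as \<open>\<rho>\<close>.\<close>

lemma balanced_eta:
  assumes "\<And>i. bd i > 0"
  shows "balanced bd bu bz ((eta bd bu bz)(0 := 1))"
  unfolding balanced_def
proof
  fix j
  have nz: "bd i \<noteq> 0" for i
    using assms[of i] by simp
  show "bd (j + 2) * ((eta bd bu bz)(0 := 1)) (j + 2)
      = bw bd bu bz (Suc j) * ((eta bd bu bz)(0 := 1)) (Suc j)
        - bu j * ((eta bd bu bz)(0 := 1)) j"
    using nz by (cases j) (simp_all add: numeral_2_eq_2 numeral_3_eq_3)
qed

lemma balanced_uminus:
  "balanced bd bu bz y \<Longrightarrow> balanced bd bu bz (\<lambda>j. - y j)"
  by (simp add: balanced_def)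

text \<open>Since \<open>b\<^sub>j\<^sup>d \<noteq> 0\<close>, the balance equations determine each value from the two before it, so the
  solution space is two-dimensional.\<close>

lemma balanced_eq_rho_eta:
  assumes bd_pos: "\<And>i. bd i > 0" and y: "balanced bd bu bz y"
  shows "y (Suc j) = y 1 * rho bd bu bz (Suc j) + y 0 * eta bd bu bz (Suc j)"
proof -
  let ?r = "rho bd bu bz" and ?e = "(eta bd bu bz)(0 := 1)"
  have r: "balanced bd bu bz ?r" and e: "balanced bd bu bz ?e"
    using balanced_rho balanced_eta bd_pos by blast+
  have "y j = y 1 * ?r j + y 0 * ?e j \<and> y (Suc j) = y 1 * ?r (Suc j) + y 0 * ?e (Suc j)"
  proof (induction j)
    case 0
    show ?case by simp
  next
    case (Suc j)
    have "bd (Suc (Suc j)) * y (Suc (Suc j))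
        = bw bd bu bz (Suc j) * y (Suc j) - bu j * y j"
      using balancedD[OF y] .
    also have "\<dots> = y 1 * (bw bd bu bz (Suc j) * ?r (Suc j) - bu j * ?r j)
        + y 0 * (bw bd bu bz (Suc j) * ?e (Suc j) - bu j * ?e j)"
      unfolding Suc.IH[THEN conjunct1] Suc.IH[THEN conjunct2] by (simp add: algebra_simps)
    also have "\<dots> = y 1 * (bd (Suc (Suc j)) * ?r (Suc (Suc j)))
        + y 0 * (bd (Suc (Suc j)) * ?e (Suc (Suc j)))"
      using balancedD[OF r, of j] balancedD[OF e, of j] by (simp only:)
    also have "\<dots> = bd (Suc (Suc j)) * (y 1 * ?r (Suc (Suc j)) + y 0 * ?e (Suc (Suc j)))"
      by (simp only: distrib_left mult.left_commute)
    finally have "y (Suc (Suc j)) = y 1 * ?r (Suc (Suc j)) + y 0 * ?e (Suc (Suc j))"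
      using bd_pos[of "Suc (Suc j)"] by simp
    with Suc.IH show ?case by blast
  qed
  then show ?thesis by simp
qed

text \<open>A conservation law: as \<open>b\<^sub>j\<^sup>w = b\<^sub>j\<^sup>z + b\<^sub>j\<^sup>d + b\<^sub>j\<^sup>u\<close>, the balance equation at \<open>j\<close> says that the net
  flux from \<open>j + 1\<close> down to \<open>j\<close> exceeds the one from \<open>j\<close> down to \<open>j - 1\<close> exactly by the direct
  outflow \<open>b\<^sub>j\<^sup>z y\<^sub>j\<close> from \<open>j\<close> to \<open>0\<close>. The right-hand side is the truncated denominator for \<open>\<rho>\<close>
  and the truncated numerator for \<open>-\<eta>\<close>.\<close>

lemma balanced_flux:
  assumes "balanced bd bu bz y"
  shows "bd (Suc j) * y (Suc j) - bu j * y j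
    = bd 1 * y 1 - bu 0 * y 0 + (\<Sum>i=1..j. bz i * y i)"
proof (induction j)
  case (Suc j)
  then show ?case
    using balancedD[OF assms, of j] by (simp add: bw_def algebra_simps)
qed simp

text \<open>Signs propagate through the flux: non-negativity up to \<open>j\<close> makes the flux into \<open>j\<close>
  non-negative, and \<open>b\<^sub>j\<^sub>+\<^sub>1\<^sup>d y\<^sub>j\<^sub>+\<^sub>1\<close> is that flux plus \<open>b\<^sub>j\<^sup>u y\<^sub>j\<close>.\<close>

lemma balanced_nonneg:
  assumes bd_pos: "\<And>i. bd i > 0" and bu_pos: "\<And>i. bu i > 0"
    and bz_nonneg: "\<And>i. i \<ge> 1 \<Longrightarrow> bz i \<ge> 0"
    and y: "balanced bd bu bz y" "y 0 \<le> 0" "y 1 \<ge> 0"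
  shows "y (Suc j) \<ge> 0"
proof (induction j rule: less_induct)
  case (less j)
  show ?case
  proof (cases j)
    case 0
    then show ?thesis using y(3) by simp
  next
    case (Suc k)
    have nonneg: "y i \<ge> 0" if "1 \<le> i" "i \<le> j" for i
      using less[of "i - 1"] that by simp
    have "(\<Sum>i=1..j. bz i * y i) \<ge> 0"
      using nonneg bz_nonneg by (intro sum_nonneg) simp
    moreover have "bd 1 * y 1 \<ge> 0" "bu 0 * y 0 \<le> 0" "bu j * y j \<ge> 0"
      using bd_pos[of 1] bu_pos[of 0] bu_pos[of j] y(2,3) nonneg[of j] Suc
      by (simp_all add: mult_nonneg_nonpos)
    ultimately have "bd (Suc j) * y (Suc j) \<ge> 0"
      using balanced_flux[OF y(1), of j] by linarith
    then show ?thesis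
      using bd_pos[of "Suc j"] by (simp add: zero_le_mult_iff)
  qed
qed

lemma rho_nonneg:
  assumes "\<And>i. bd i > 0" "\<And>i. bu i > 0" "\<And>i. i \<ge> 1 \<Longrightarrow> bz i \<ge> 0"
  shows "rho bd bu bz (Suc j) \<ge> 0"
  using balanced_nonneg[OF assms balanced_rho[OF assms(1)]] by simp

lemma eta_nonpos:
  assumes "\<And>i. bd i > 0" "\<And>i. bu i > 0" "\<And>i. i \<ge> 1 \<Longrightarrow> bz i \<ge> 0"
  shows "eta bd bu bz (Suc j) \<le> 0"
  using balanced_nonneg[OF assms balanced_uminus[OF balanced_eta[OF assms(1)]], where j = j] by simp

lemma balanced_left_product:
  assumes "\<And>j. (\<lambda>k. x k * Bmat bd bu bz k (Suc j)) sums 0"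
  shows "balanced bd bu bz x"
  unfolding balanced_def
proof
  fix j
  let ?f = "\<lambda>k. x k * Bmat bd bu bz k (Suc j)"
  have entries: "Bmat bd bu bz j (Suc j) = bu j"
    "Bmat bd bu bz (Suc j) (Suc j) = - bw bd bu bz (Suc j)"
    "Bmat bd bu bz (Suc (Suc j)) (Suc j) = bd (Suc (Suc j))"
    by (auto simp: Bmat_def numeral_2_eq_2)
  \<comment> \<open>A column other than the first has only three entries, so its equation is a finite sum.\<close>
  have "?f sums sum ?f {j, Suc j, Suc (Suc j)}"
    by (rule sums_finite) (auto simp: Bmat_def)
  with assms[of j] have "sum ?f {j, Suc j, Suc (Suc j)} = 0"
    by (rule sums_unique2[symmetric])
  then show "bd (j + 2) * x (j + 2) = bw bd bu bz (Suc j) * x (Suc j) - bu j * x j"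
    by (simp add: entries algebra_simps)
qed

lemma Bmat_first_column_sums:
  assumes "(\<lambda>k. x k * Bmat bd bu bz k 0) sums s"
  shows "(\<lambda>j. bz (Suc j) * x (Suc j)) sums (s + (bd 0 + bu 0) * x 0 - bd 1 * x 1)"
proof -
  let ?f = "\<lambda>k. x k * Bmat bd bu bz k 0"
  have "(\<lambda>j. ?f (Suc j)) sums (s - ?f 0)"
    using assms by (subst sums_Suc_iff) simp
  \<comment> \<open>The entry \<open>B(1,0)\<close> contains \<open>b\<^sub>1\<^sup>d\<close> besides \<open>b\<^sub>1\<^sup>z\<close>; that part is split off.\<close>
  from sums_diff[OF this sums_single[of 0 "\<lambda>_. bd 1 * x 1"]]
  have "(\<lambda>j. ?f (Suc j) - (if j = 0 then bd 1 * x 1 else 0)) sums (s - ?f 0 - bd 1 * x 1)" .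
  moreover have "?f (Suc j) - (if j = 0 then bd 1 * x 1 else 0) = bz (Suc j) * x (Suc j)" for j
    by (simp add: Bmat_def algebra_simps)
  moreover have "s - ?f 0 - bd 1 * x 1 = s + (bd 0 + bu 0) * x 0 - bd 1 * x 1"
    by (simp add: Bmat_def algebra_simps)
  ultimately show ?thesis by (simp only:)
qed

theorem proposition3:
  fixes bd bu bz :: "nat \<Rightarrow> real" and c :: "nat \<Rightarrow> nat \<Rightarrow> real"
  assumes bd_pos: "\<And>i. bd i > 0"
    and bu_pos: "\<And>i. bu i > 0"
    and bz_nonneg: "\<And>i. i \<ge> 1 \<Longrightarrow> bz i \<ge> 0"
    and bw_pos: "\<And>i. i \<ge> 1 \<Longrightarrow> bw bd bu bz i > 0"
    and inverse: "is_matrix_inverse (Bmat bd bu bz) c"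
    and c00: "c 0 0 = - 1 / bd 0"
  shows "(\<forall>n. bd 1 + (\<Sum>j=1..n. bz j * rho bd bu bz j) \<noteq> 0)
    \<and> (\<lambda>n. (bu 0 - (\<Sum>j=1..n. bz j * eta bd bu bz j))
             / (bd 1 + (\<Sum>j=1..n. bz j * rho bd bu bz j))) \<longlonglongrightarrow> c 0 1 / c 0 0
    \<and> (summable (\<lambda>j. bz (Suc j) * eta bd bu bz (Suc j)) \<longleftrightarrow>
        summable (\<lambda>j. bz (Suc j) * rho bd bu bz (Suc j)))
    \<and> (summable (\<lambda>j. bz (Suc j) * rho bd bu bz (Suc j)) \<longrightarrow>
        bd 1 + (\<Sum>j. bz (Suc j) * rho bd bu bz (Suc j)) \<noteq> 0
        \<and> c 0 1 / c 0 0 =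
            (bu 0 - (\<Sum>j. bz (Suc j) * eta bd bu bz (Suc j)))
              / (bd 1 + (\<Sum>j. bz (Suc j) * rho bd bu bz (Suc j))))"
proof -
  let ?r = "rho bd bu bz" and ?e = "eta bd bu bz"
  define g where "g = c 0 1 / c 0 0"
  define D where "D n = bd 1 + (\<Sum>j=1..n. bz j * ?r j)" for n
  define N where "N n = bu 0 - (\<Sum>j=1..n. bz j * ?e j)" for n
  have c00_nz: "c 0 0 \<noteq> 0"
    using c00 bd_pos[of 0] by simp
  have row: "(\<lambda>k. c 0 k * Bmat bd bu bz k j) sums id_matrix 0 j" for j
    using inverse by (simp add: is_matrix_inverse_def matrix_prod_is_def)
  have bal: "balanced bd bu bz (c 0)"
    by (rule balanced_left_product) (use row[of "Suc _"] in \<open>simp add: id_matrix_def\<close>)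
  \<comment> \<open>The value of \<open>c(0,0)\<close> cancels the right-hand side \<open>1\<close> of the equation of column \<open>0\<close>.\<close>
  have "1 + (bd 0 + bu 0) * c 0 0 = bu 0 * c 0 0"
    using c00 bd_pos[of 0] by (simp add: field_simps)
  then have "(\<lambda>j. bz (Suc j) * c 0 (Suc j)) sums (bu 0 * c 0 0 - bd 1 * c 0 1)"
    using Bmat_first_column_sums[OF row[of 0]] by (simp add: id_matrix_def)
  from sums_divide[OF this, of "c 0 0"]
  have "(\<lambda>j. bz (Suc j) * c 0 (Suc j) / c 0 0) sums (bu 0 - bd 1 * g)"
    using c00_nz by (simp add: g_def diff_divide_distrib)
  moreover have "bz (Suc j) * c 0 (Suc j) / c 0 0
      = g * (bz (Suc j) * ?r (Suc j)) + bz (Suc j) * ?e (Suc j)" for j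
    unfolding balanced_eq_rho_eta[OF bd_pos bal] g_def using c00_nz by (simp add: field_simps)
  ultimately have comb: "(\<lambda>j. g * (bz (Suc j) * ?r (Suc j)) + bz (Suc j) * ?e (Suc j))
      sums (bu 0 - bd 1 * g)"
    by simp

  have D_Suc: "D n = bd 1 + (\<Sum>j<n. bz (Suc j) * ?r (Suc j))"
    and N_Suc: "N n = bu 0 - (\<Sum>j<n. bz (Suc j) * ?e (Suc j))" for n
    by (simp_all add: D_def N_def sum.atLeast1_atMost_eq)
  have D_ge: "D n \<ge> bd 1" for n
    unfolding D_Suc using rho_nonneg[OF bd_pos bu_pos bz_nonneg] bz_nonneg
    by (simp add: sum_nonneg)
  have N_ge: "N n \<ge> bu 0" for n
    unfolding N_Suc using eta_nonpos[OF bd_pos bu_pos bz_nonneg] bz_nonneg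
    by (simp add: sum_nonpos mult_nonneg_nonpos)
  have D_pos: "D n > 0" for n
    using D_ge[of n] bd_pos[of 1] by linarith

  have "(\<lambda>n. (\<Sum>j<n. g * (bz (Suc j) * ?r (Suc j)) + bz (Suc j) * ?e (Suc j))
      - (bu 0 - bd 1 * g)) \<longlonglongrightarrow> 0"
    using comb unfolding sums_def by (rule LIM_zero)
  then have diff_0: "(\<lambda>n. g * D n - N n) \<longlonglongrightarrow> 0"
    by (simp add: D_Suc N_Suc sum.distrib sum_distrib_left algebra_simps)

  have "(\<lambda>n. (g * D n - N n) / D n) \<longlonglongrightarrow> 0"
  proof (rule tendsto_0_le[OF diff_0])
    have "norm ((g * D n - N n) / D n) \<le> norm (g * D n - N n) * (1 / bd 1)" for n
      using D_ge[of n] D_pos[of n] bd_pos[of 1] by (simp add: frac_le)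
    then show "\<forall>\<^sub>F n in sequentially.
        norm ((g * D n - N n) / D n) \<le> norm (g * D n - N n) * (1 / bd 1)"
      by simp
  qed
  from tendsto_diff[OF tendsto_const[of g] this]
  have lim: "(\<lambda>n. N n / D n) \<longlonglongrightarrow> g"
    using D_pos by (simp add: diff_divide_distrib less_imp_neq[symmetric])

  have g_nz: "g \<noteq> 0"
  proof
    assume "g = 0"
    with diff_0 have "(\<lambda>n. - N n) \<longlonglongrightarrow> 0"
      by simp
    then have "0 \<le> - bu 0"
      by (rule LIMSEQ_le_const2) (use N_ge in auto)
    with bu_pos[of 0] show False by simp
  qed

  have summable_iff: "summable (\<lambda>j. bz (Suc j) * ?e (Suc j))
      \<longleftrightarrow> summable (\<lambda>j. bz (Suc j) * ?r (Suc j))"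
  proof
    assume "summable (\<lambda>j. bz (Suc j) * ?e (Suc j))"
    from summable_diff[OF sums_summable[OF comb] this]
    have "summable (\<lambda>j. g * (bz (Suc j) * ?r (Suc j)))"
      by simp
    then show "summable (\<lambda>j. bz (Suc j) * ?r (Suc j))"
      using g_nz by (simp only: summable_cmult_iff) simp
  next
    assume "summable (\<lambda>j. bz (Suc j) * ?r (Suc j))"
    from summable_diff[OF sums_summable[OF comb] summable_mult[OF this, of g]]
    show "summable (\<lambda>j. bz (Suc j) * ?e (Suc j))"
      by simp
  qed

  have quotient_eq: "bd 1 + (\<Sum>j. bz (Suc j) * ?r (Suc j)) \<noteq> 0
      \<and> g = (bu 0 - (\<Sum>j. bz (Suc j) * ?e (Suc j)))
          / (bd 1 + (\<Sum>j. bz (Suc j) * ?r (Suc j)))"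
    if r: "summable (\<lambda>j. bz (Suc j) * ?r (Suc j))"
  proof
    have e: "summable (\<lambda>j. bz (Suc j) * ?e (Suc j))"
      using r summable_iff by blast
    have D_lim: "D \<longlonglongrightarrow> bd 1 + (\<Sum>j. bz (Suc j) * ?r (Suc j))"
      unfolding D_Suc by (intro tendsto_intros summable_LIMSEQ r)
    have N_lim: "N \<longlonglongrightarrow> bu 0 - (\<Sum>j. bz (Suc j) * ?e (Suc j))"
      unfolding N_Suc by (intro tendsto_intros summable_LIMSEQ e)
    have "bd 1 \<le> bd 1 + (\<Sum>j. bz (Suc j) * ?r (Suc j))"
      by (rule LIMSEQ_le_const[OF D_lim]) (use D_ge in auto)
    with bd_pos[of 1] show nz: "bd 1 + (\<Sum>j. bz (Suc j) * ?r (Suc j)) \<noteq> 0"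
      by linarith
    show "g = (bu 0 - (\<Sum>j. bz (Suc j) * ?e (Suc j)))
          / (bd 1 + (\<Sum>j. bz (Suc j) * ?r (Suc j)))"
      by (rule LIMSEQ_unique[OF lim tendsto_divide[OF N_lim D_lim nz]])
  qed

  have "\<forall>n. D n \<noteq> 0"
    using D_pos by (simp add: less_imp_neq[symmetric])
  with lim summable_iff quotient_eq show ?thesis
    unfolding g_def D_def N_def by blast
qed

end
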